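(* Let $q>1$ be any prime power, and for each positive integer $n$ let $N_n(q)$ denote the number of monic irreducible polynomials of degree $n$ over the finite field $\mathbb{F}_q$. Then: (1) the sequence $\big(\sqrt[n]{N_n(q)}\big)_{n>e^{3+7/(q-1)^2}}$ is strictly increasing, i.e. $\sqrt[n+1]{N_{n+1}(q)}>\sqrt[n]{N_n(q)}$ for every integer $n>e^{3+7/(q-1)^2}$; (2) the sequence $\big(\sqrt[n+1]{N_{n+1}(q)}/\sqrt[n]{N_n(q)}\big)_{n\geq 5.835\times 10^{14}}$ is strictly decreasing; (3) if $q\geq 9$, then the sequence $\big(N_{n+1}(q)/N_n(q)\big)_{n\geq 1}$ is strictly increasing; (4) if $q<9$, then the sequence $\big(N_{n+1}(q)/N_n(q)\big)_{n\geq 19}$ is strictly increasing.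
   Context: $\mathbb{F}_q$ denotes the finite field with $q$ elements. *)

theory Defs
  imports
    "HOL-Analysis.Analysis"
    "HOL-Computational_Algebra.Computational_Algebra"
    "HOL-Number_Theory.Prime_Powers"
begin

(* The field F_q is a type 'a of class finite_field with CARD('a) = q, passed as TYPE('a).
   The counted set is finite, since 'a is, so card takes no default value here. *)
definition num_monic_irreducible :: "'a :: finite_field itself \<Rightarrow> nat \<Rightarrow> nat" where
  "num_monic_irreducible _ n =
     card {p :: 'a poly. lead_coeff p = 1 \<and> irreducible p \<and> degree p = n}"

end

(* Counting, over all monic f of degree n, the pairs (p, k) with p monic irreducible and p^k
   dividing f, each weighted by deg p, gives n q^n = sum_{m=1}^n q^(n-m) G(m) with
   G(m) = sum_{d | m} d N_d. Comparing n with n + 1 yields Gauss's formula G(n) = q^n, hence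
   q^n (1 - e_n) <= n N_n <= q^n with e_n = q / (q - 1) * q^(-n/2).
   So ln N_n / n is ln q - ln n / n up to an exponentially small error, and (1), (2) reduce to the
   monotonicity and convexity of ln x / x. Likewise N_n N_(n+2) / N_(n+1)^2 is about
   (n+1)^2 / (n (n+2)), which wins by the margin 1/(n+1)^2 as soon as e_n + e_(n+2) is below it;
   this leaves n = 1, 2 for q >= 9 and n = 19, 20, 21 for q = 2, where N_n is computed exactly. *)
theory Submission
  imports Defs
begin

section \<open>Gauss's formula\<close>

definition monic_polys :: "nat \<Rightarrow> 'a::field poly set" where
  "monic_polys n = {p. lead_coeff p = 1 \<and> degree p = n}"

definition monic_irreducibles :: "nat \<Rightarrow> 'a::field poly set" where
  "monic_irreducibles n = {p \<in> monic_polys n. irreducible p}"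

lemma monic_polys_Suc:
  "monic_polys (Suc n) = (\<lambda>(a, p). pCons a p) ` (UNIV \<times> monic_polys n)"
proof (intro equalityI subsetI)
  fix f :: "'a poly" assume f: "f \<in> monic_polys (Suc n)"
  obtain a p where ap: "f = pCons a p" by (cases f)
  with f have "p \<noteq> 0" by (auto simp: monic_polys_def split: if_splits)
  with f ap show "f \<in> (\<lambda>(a, p). pCons a p) ` (UNIV \<times> monic_polys n)"
    by (auto simp: monic_polys_def)
qed (auto simp: monic_polys_def)

lemma finite_card_monic_polys:
  "finite (monic_polys n :: 'a::finite_field poly set) \<and>
   card (monic_polys n :: 'a poly set) = CARD('a) ^ n"
proof (induction n)
  case 0
  have "monic_polys 0 = {1 :: 'a poly}"
    by (auto simp: monic_polys_def one_pCons elim!: degree_eq_zeroE)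
  then show ?case by simp
next
  case (Suc n)
  have "inj_on (\<lambda>(a, p). pCons a p) (UNIV \<times> (monic_polys n :: 'a poly set))"
    by (auto simp: inj_on_def)
  with Suc show ?case
    by (simp add: monic_polys_Suc card_image card_cartesian_product)
qed

lemmas finite_monic_polys = finite_card_monic_polys[THEN conjunct1]
lemmas card_monic_polys = finite_card_monic_polys[THEN conjunct2]

text \<open>Multiplication by g is a bijection from the monic polynomials of degree n - e onto the
  monic multiples of g of degree n.\<close>

lemma card_monic_multiples:
  fixes g :: "'a::finite_field poly"
  assumes g: "g \<in> monic_polys e" and "e \<le> n"
  shows "card {f \<in> monic_polys n. g dvd f} = CARD('a) ^ (n - e)"
proof -
  have g0: "g \<noteq> 0" using g by (auto simp: monic_polys_def)
  have "{f \<in> monic_polys n. g dvd f} = (*) g ` monic_polys (n - e)"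
  proof (intro equalityI subsetI)
    fix f assume f: "f \<in> {f \<in> monic_polys n. g dvd f}"
    then obtain h where h: "f = g * h" by (auto simp: dvd_def)
    with f have "h \<noteq> 0" by (auto simp: monic_polys_def)
    have "lead_coeff f = lead_coeff g * lead_coeff h" by (simp add: h lead_coeff_mult)
    with f g have "lead_coeff h = 1" by (auto simp: monic_polys_def)
    with f g g0 h \<open>h \<noteq> 0\<close> have "h \<in> monic_polys (n - e)"
      by (auto simp: monic_polys_def degree_mult_eq)
    with h show "f \<in> (*) g ` monic_polys (n - e)" by blast
  next
    fix f assume "f \<in> (*) g ` monic_polys (n - e)"
    then obtain h where h: "h \<in> monic_polys (n - e)" "f = g * h" by blast
    then have "h \<noteq> 0" by (auto simp: monic_polys_def)
    with g g0 h \<open>e \<le> n\<close> have "degree f = n"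
      by (auto simp: monic_polys_def degree_mult_eq)
    moreover have "lead_coeff f = lead_coeff g * lead_coeff h" by (simp add: h lead_coeff_mult)
    then have "lead_coeff f = 1" using g h(1) by (auto simp: monic_polys_def)
    ultimately
    show "f \<in> {f \<in> monic_polys n. g dvd f}"
      using h(2) by (simp add: monic_polys_def)
  qed
  moreover have "inj_on ((*) g) (monic_polys (n - e))"
    using g0 by (auto simp: inj_on_def)
  ultimately show ?thesis by (simp add: card_image card_monic_polys)
qed

section \<open>Factorization into monic irreducibles\<close>

lemma degree_monic_irreducible_pos:
  assumes "p \<in> monic_irreducibles d" shows "d > 0"
proof (rule ccontr)
  assume "\<not> d > 0"
  with assms have "is_unit p"
    by (subst is_unit_iff_degree) (auto simp: monic_irreducibles_def monic_polys_def)
  with assms show False by (simp add: monic_irreducibles_def irreducible_not_unit)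
qed

text \<open>Descent on the degree: a reducible f has a factor of smaller positive degree, and an
  irreducible f only has to be made monic.\<close>

lemma exists_monic_irreducible_dvd:
  fixes f :: "'a::field poly"
  assumes "degree f > 0"
  shows "\<exists>p. lead_coeff p = 1 \<and> irreducible p \<and> p dvd f"
  using assms
proof (induction "degree f" arbitrary: f rule: less_induct)
  case less
  have f0: "f \<noteq> 0" using less.prems by auto
  show ?case
  proof (cases "irreducible f")
    case True
    define p where "p = smult (inverse (lead_coeff f)) f"
    have "p = [:inverse (lead_coeff f):] * f" by (simp add: p_def)
    moreover have "is_unit [:inverse (lead_coeff f):]"
      using f0 by (simp add: is_unit_iff_degree)
    ultimately have "irreducible p" "p dvd f"
      using True f0 by (auto simp: irreducible_mult_unit_left p_def smult_dvd_iff simp del: mult_pCons_left)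
    moreover have "lead_coeff p = 1" using f0 by (simp add: p_def)
    ultimately show ?thesis by blast
  next
    case False
    have "\<not> is_unit f" using less.prems by (simp add: is_unit_iff_degree f0)
    with False f0 obtain a b where ab: "f = a * b" "\<not> is_unit a" "\<not> is_unit b"
      by (auto simp: irreducible_def)
    with f0 have "a \<noteq> 0" "b \<noteq> 0" by auto
    with ab have "degree a > 0" "degree a < degree f"
      by (auto simp: degree_mult_eq is_unit_iff_degree)
    with less.hyps[of a] ab show ?thesis by (meson dvd_mult2)
  qed
qed

text \<open>Encodes multiplicities as a plain set: for nonzero f, each p occurs in as many pairs as
  its multiplicity in f.\<close>

definition prime_power_divisors :: "'a::field poly \<Rightarrow> ('a poly \<times> nat) set" where
  "prime_power_divisors f = {(p, k). lead_coeff p = 1 \<and> irreducible p \<and> k > 0 \<and> p ^ k dvd f}"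

text \<open>Induction on k: once r^k is extracted from g, the remaining r divides p times the
  cofactor, hence the cofactor by primality.\<close>

lemma prime_elem_power_dvd_cancel:
  fixes r :: "'a::idom"
  assumes "prime_elem r" "\<not> r dvd p" "r ^ k dvd p * g"
  shows "r ^ k dvd g"
  using assms(3)
proof (induction k)
  case (Suc k)
  then have "r ^ k dvd g" by (metis dvd_mult_right power_Suc)
  then obtain h where h: "g = r ^ k * h" by (auto simp: dvd_def)
  have r0: "r \<noteq> 0" using assms(1) by auto
  have "r ^ k * r dvd r ^ k * (p * h)"
    using Suc.prems by (simp add: h algebra_simps)
  with r0 have "r dvd p * h" by simp
  with assms(1,2) have "r dvd h" by (simp add: prime_elem_dvd_mult_iff)
  then show ?case by (simp add: h mult.commute mult_dvd_mono)
qed simp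

text \<open>The cofactor of r in p is a unit, so a constant, and the leading coefficients force it
  to be 1.\<close>

lemma monic_irreducible_dvd_imp_eq:
  fixes p r :: "'a::field poly"
  assumes "irreducible p" "irreducible r" "lead_coeff p = 1" "lead_coeff r = 1" "r dvd p"
  shows "r = p"
proof -
  obtain c where c: "p = r * c" using assms(5) by (auto simp: dvd_def)
  have "is_unit c" using assms(1,2) c by (auto simp: irreducible_def)
  then obtain a where "c = [:a:]" by (auto simp: is_unit_poly_iff)
  then have eq: "p = smult a r" using c by simp
  then have "lead_coeff p = a * lead_coeff r" by simp
  with assms(3,4) eq show ?thesis by simp
qed

text \<open>Multiplying by p raises the multiplicity of p by one and changes no other:
  \<open>\<phi>\<close> shifts the exponents of p up, which frees the place of (p, 1).\<close>

lemma prime_power_divisors_mult: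
  fixes p g :: "'a::field poly"
  assumes p: "irreducible p" "lead_coeff p = 1"
  defines "\<phi> \<equiv> \<lambda>(r, k). (r, if r = p then Suc k else k)"
  shows "prime_power_divisors (p * g) = insert (p, 1) (\<phi> ` prime_power_divisors g)"
proof (intro equalityI subsetI)
  fix x assume "x \<in> prime_power_divisors (p * g)"
  then obtain r k where x: "x = (r, k)" "lead_coeff r = 1" "irreducible r" "k > 0" "r ^ k dvd p * g"
    by (auto simp: prime_power_divisors_def)
  show "x \<in> insert (p, 1) (\<phi> ` prime_power_divisors g)"
  proof (cases "r = p")
    case True
    from x(4) obtain j where j: "k = Suc j" by (cases k) auto
    have "p ^ j dvd g" using x True p j by auto
    then have "j > 0 \<Longrightarrow> (p, j) \<in> prime_power_divisors g"
      using p by (auto simp: prime_power_divisors_def)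
    moreover have "x = \<phi> (p, j)" using x True j by (simp add: \<phi>_def)
    ultimately show ?thesis using x j True by (cases "j = 0") auto
  next
    case False
    then have "\<not> r dvd p" using monic_irreducible_dvd_imp_eq x p by blast
    then have "r ^ k dvd g"
      using prime_elem_power_dvd_cancel x field_poly_irreducible_imp_prime by blast
    then have "(r, k) \<in> prime_power_divisors g" using x by (auto simp: prime_power_divisors_def)
    moreover have "x = \<phi> (r, k)" using x False by (simp add: \<phi>_def)
    ultimately show ?thesis by blast
  qed
next
  fix x assume "x \<in> insert (p, 1) (\<phi> ` prime_power_divisors g)"
  then show "x \<in> prime_power_divisors (p * g)"
    using p by (auto simp: prime_power_divisors_def \<phi>_def mult_dvd_mono)
qed

text \<open>Strong induction, splitting off one monic irreducible p: the only new pair (p, 1)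
  contributes degree p, and \<open>\<phi>\<close> preserves first components.\<close>

lemma degree_eq_sum_prime_power_divisors:
  fixes f :: "'a::field poly"
  assumes "f \<noteq> 0"
  shows "finite (prime_power_divisors f) \<and>
         (\<Sum>(p, k)\<in>prime_power_divisors f. degree p) = degree f"
  using assms
proof (induction "degree f" arbitrary: f rule: less_induct)
  case less
  show ?case
  proof (cases "degree f = 0")
    case True
    have "prime_power_divisors f = {}"
    proof (rule ccontr)
      assume "prime_power_divisors f \<noteq> {}"
      then obtain p k where pk: "irreducible p" "k > 0" "p ^ k dvd f"
        by (auto simp: prime_power_divisors_def)
      then have "p dvd f" by (meson dvd_power dvd_trans)
      moreover have "is_unit f" using True less.prems by (simp add: is_unit_iff_degree)
      ultimately show False using pk by (meson dvd_trans irreducible_not_unit)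
    qed
    then show ?thesis using True by simp
  next
    case False
    then obtain p where p: "lead_coeff p = 1" "irreducible p" "p dvd f"
      using exists_monic_irreducible_dvd by blast
    then obtain g where g: "f = p * g" by (auto simp: dvd_def)
    have pg: "p \<noteq> 0" "g \<noteq> 0" using less.prems g by auto
    have "degree p > 0" using p pg by (metis gr0I irreducible_not_unit is_unit_iff_degree)
    then have deg: "degree f = degree p + degree g" "degree g < degree f"
      using g pg by (auto simp: degree_mult_eq)
    define \<phi> :: "'a poly \<times> nat \<Rightarrow> _" where "\<phi> = (\<lambda>(r, k). (r, if r = p then Suc k else k))"
    have inj: "inj_on \<phi> (prime_power_divisors g)"
      by (auto simp: inj_on_def \<phi>_def split: if_splits)
    \<comment> \<open>Exponents in \<open>prime_power_divisors g\<close> are positive, so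
      \<open>\<phi>\<close> gives p an exponent of at least 2.\<close>
    have notin: "(p, 1) \<notin> \<phi> ` prime_power_divisors g"
      by (auto simp: \<phi>_def prime_power_divisors_def split: if_splits)
    have eq: "prime_power_divisors f = insert (p, 1) (\<phi> ` prime_power_divisors g)"
      unfolding g \<phi>_def using prime_power_divisors_mult p by blast
    have IH: "finite (prime_power_divisors g)"
      "(\<Sum>(r, k)\<in>prime_power_divisors g. degree r) = degree g"
      using less.hyps deg pg by auto
    have "(\<Sum>(r, k)\<in>\<phi> ` prime_power_divisors g. degree r) = degree g"
      unfolding IH(2)[symmetric]
      by (subst sum.reindex[OF inj]) (auto simp: \<phi>_def intro!: sum.cong)
    then show ?thesis using IH notin by (simp add: eq deg)
  qed
qed

section \<open>Double counting of prime power divisors\<close>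

lemma num_monic_irreducible_eq:
  "num_monic_irreducible TYPE('a::finite_field) n = card (monic_irreducibles n :: 'a poly set)"
  unfolding num_monic_irreducible_def monic_irreducibles_def monic_polys_def
  by (rule arg_cong[where f = card]) auto

text \<open>Both sides are the total degree of all monic polynomials of degree n, computed directly
  and through \<open>prime_power_divisors\<close>. The case n = 0 is included because the recursion
  for Gauss's formula starts there.\<close>

lemma sum_degree_prime_powers:
  fixes n :: nat
  shows "n * CARD('a::finite_field) ^ n =
    (\<Sum>m = 1..n. (\<Sum>d | d dvd m. d * num_monic_irreducible TYPE('a) d) * CARD('a) ^ (n - m))"
proof -
  define Irr :: "nat \<Rightarrow> 'a poly set" where "Irr = monic_irreducibles"
  \<comment> \<open>A triple (m, d, p) stands for the power p^(m/d), of degree m. The index set is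
    independent of f, so that the sums can be interchanged.\<close>
  define X where "X = (SIGMA m:{1..n}. SIGMA d:{d. d dvd m}. Irr d)"
  have finIrr: "finite (Irr d)" for d
    using finite_monic_polys[of d] by (rule rev_finite_subset) (auto simp: Irr_def monic_irreducibles_def)
  have finX: "finite X"
    unfolding X_def using finIrr by (intro finite_SigmaI) auto
  have X: "(m, d, p) \<in> X \<longleftrightarrow> 1 \<le> m \<and> m \<le> n \<and> d dvd m \<and> p \<in> Irr d" for m d p
    by (auto simp: X_def)
  have deg: "degree f = (\<Sum>(m, d, p)\<in>X. if p ^ (m div d) dvd f then d else 0)"
    if f: "f \<in> monic_polys n" for f
  proof -
    define \<psi> :: "'a poly \<times> nat \<Rightarrow> _" where "\<psi> = (\<lambda>(p, k). (k * degree p, degree p, p))"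
    have f0: "f \<noteq> 0" using f by (auto simp: monic_polys_def)
    have pos: "degree p > 0" if "lead_coeff p = 1" "irreducible p" for p :: "'a poly"
      using degree_monic_irreducible_pos[of p "degree p"] that
      by (simp add: monic_irreducibles_def monic_polys_def)
    have inj: "inj_on \<psi> (prime_power_divisors f)"
      using pos by (force simp: inj_on_def \<psi>_def prime_power_divisors_def)
    \<comment> \<open>A pair (p, k) becomes the triple with m = k * degree p; here m <= n because
      p^k divides f, which has degree n.\<close>
    have img: "\<psi> ` prime_power_divisors f = {(m, d, p) \<in> X. p ^ (m div d) dvd f}"
    proof (intro equalityI subsetI)
      fix x assume "x \<in> \<psi> ` prime_power_divisors f"
      then obtain p k where pk: "x = (k * degree p, degree p, p)" "lead_coeff p = 1" "irreducible p"
        "k > 0" "p ^ k dvd f" by (auto simp: \<psi>_def prime_power_divisors_def)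
      have "degree (p ^ k) \<le> degree f" using pk f0 dvd_imp_degree_le by blast
      moreover have "p \<noteq> 0" using pk(2) by auto
      ultimately have "k * degree p \<le> n" using f by (simp add: degree_power_eq monic_polys_def)
      with pk pos[of p] show "x \<in> {(m, d, p) \<in> X. p ^ (m div d) dvd f}"
        by (auto simp: X Irr_def monic_irreducibles_def monic_polys_def)
    next
      fix x assume "x \<in> {(m, d, p) \<in> X. p ^ (m div d) dvd f}"
      then obtain m d p where x: "x = (m, d, p)" "1 \<le> m" "d dvd m" "p \<in> Irr d" "p ^ (m div d) dvd f"
        by (auto simp: X)
      have "(p, m div d) \<in> prime_power_divisors f"
        using x by (auto simp: prime_power_divisors_def Irr_def monic_irreducibles_def
            monic_polys_def elim!: dvdE)
      moreover have "\<psi> (p, m div d) = x"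
        using x by (simp add: \<psi>_def Irr_def monic_irreducibles_def monic_polys_def)
      ultimately show "x \<in> \<psi> ` prime_power_divisors f" by force
    qed
    have "degree f = (\<Sum>(p, k)\<in>prime_power_divisors f. degree p)"
      using degree_eq_sum_prime_power_divisors[OF f0] by simp
    also have "\<dots> = (\<Sum>(m, d, p)\<in>\<psi> ` prime_power_divisors f. d)"
      by (subst sum.reindex[OF inj]) (auto simp: \<psi>_def intro!: sum.cong)
    also have "\<dots> = (\<Sum>(m, d, p)\<in>X. if p ^ (m div d) dvd f then d else 0)"
      unfolding img by (intro sum.mono_neutral_cong_left finX) (auto split: if_splits)
    finally show ?thesis .
  qed
  \<comment> \<open>For a fixed triple, the f to be counted are the multiples of p^(m/d), which is
    monic of degree m.\<close>
  have mult: "(\<Sum>f\<in>monic_polys n. if p ^ (m div d) dvd f then d else 0) = d * CARD('a) ^ (n - m)"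
    if "(m, d, p) \<in> X" for m d p
  proof -
    have "p \<noteq> 0" using that by (auto simp: X Irr_def monic_irreducibles_def)
    then have "degree (p ^ (m div d)) = m"
      using that by (auto simp: X Irr_def monic_irreducibles_def monic_polys_def degree_power_eq)
    moreover have "lead_coeff (p ^ (m div d)) = 1"
      using that by (auto simp: X Irr_def monic_irreducibles_def monic_polys_def lead_coeff_power)
    ultimately have "p ^ (m div d) \<in> monic_polys m" by (simp add: monic_polys_def)
    then have "card {f \<in> monic_polys n. p ^ (m div d) dvd f} = CARD('a) ^ (n - m)"
      using card_monic_multiples that X by blast
    then show ?thesis
      by (simp add: sum.If_cases[OF finite_monic_polys] Int_def)
  qed
  have "n * CARD('a) ^ n = (\<Sum>f\<in>(monic_polys n :: 'a poly set). degree f)"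
    using card_monic_polys[where 'a = 'a and n = n] by (simp add: monic_polys_def)
  also have "\<dots> = (\<Sum>f\<in>monic_polys n. \<Sum>(m, d, p)\<in>X. if p ^ (m div d) dvd f then d else 0)"
    by (intro sum.cong refl deg)
  also have "\<dots> = (\<Sum>x\<in>X. \<Sum>f\<in>monic_polys n. case x of (m, d, p) \<Rightarrow>
                   if p ^ (m div d) dvd f then d else 0)"
    by (rule sum.swap)
  also have "\<dots> = (\<Sum>(m, d, p)\<in>X. d * CARD('a) ^ (n - m))"
    using mult by (intro sum.cong) auto
  \<comment> \<open>The sum is split by m and then by d; the innermost sum over p is constant and
    produces the factor N_d.\<close>
  also have "\<dots> = (\<Sum>m = 1..n. \<Sum>(d, p)\<in>(SIGMA d:{d. d dvd m}. Irr d). d * CARD('a) ^ (n - m))"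
    unfolding X_def using finIrr by (subst sum.Sigma) (auto intro!: finite_SigmaI)
  also have "\<dots> = (\<Sum>m = 1..n. \<Sum>d | d dvd m. \<Sum>p\<in>Irr d. d * CARD('a) ^ (n - m))"
    using finIrr by (intro sum.cong refl, subst sum.Sigma) auto
  also have "\<dots> = (\<Sum>m = 1..n. (\<Sum>d | d dvd m. d * num_monic_irreducible TYPE('a) d) * CARD('a) ^ (n - m))"
    by (simp add: num_monic_irreducible_eq Irr_def sum_distrib_left mult_ac)
  finally show ?thesis .
qed

text \<open>Subtracting q times the identity for m from the one for m + 1 leaves q^(m + 1) on the
  left and only the last divisor sum on the right.\<close>

theorem sum_divisors_num_monic_irreducible:
  assumes "n > 0"
  shows "(\<Sum>d | d dvd n. d * num_monic_irreducible TYPE('a::finite_field) d) = CARD('a) ^ n"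
proof -
  let ?G = "\<lambda>m. \<Sum>d | d dvd m. d * num_monic_irreducible TYPE('a) d" and ?q = "CARD('a)"
  obtain m where m: "n = Suc m" using assms by (cases n) auto
  have "Suc m * ?q ^ Suc m = (\<Sum>i = 1..m. ?G i * ?q ^ (Suc m - i)) + ?G (Suc m)"
    using sum_degree_prime_powers[where 'a = 'a and n = "Suc m"] by simp
  also have "(\<Sum>i = 1..m. ?G i * ?q ^ (Suc m - i)) = ?q * (\<Sum>i = 1..m. ?G i * ?q ^ (m - i))"
    unfolding sum_distrib_left by (intro sum.cong) (auto simp: Suc_diff_le)
  also have "(\<Sum>i = 1..m. ?G i * ?q ^ (m - i)) = m * ?q ^ m"
    using sum_degree_prime_powers[where 'a = 'a and n = m] by simp
  finally show ?thesis unfolding m by (simp add: algebra_simps)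
qed

section \<open>Sequences satisfying Gauss's formula\<close>

lemma strict_mono_on_SucI:
  fixes f :: "nat \<Rightarrow> real"
  assumes up: "\<And>m n. m \<in> S \<Longrightarrow> m \<le> n \<Longrightarrow> n \<in> S" and step: "\<And>n. n \<in> S \<Longrightarrow> f n < f (Suc n)"
  shows "strict_mono_on S f"
proof (rule strict_mono_onI)
  fix m n assume "m \<in> S" "n \<in> S" "m < n"
  from \<open>m < n\<close> have "Suc m \<le> n" by simp
  then show "f m < f n"
  proof (induction n rule: dec_induct)
    case (step k)
    then have "k \<in> S" using up[OF \<open>m \<in> S\<close>, of k] by simp
    with step.IH assms(2) show ?case by fastforce
  qed (use \<open>m \<in> S\<close> assms(2) in auto)
qed

lemma strict_antimono_on_SucI:
  fixes f :: "nat \<Rightarrow> real"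
  assumes "\<And>m n. m \<in> S \<Longrightarrow> m \<le> n \<Longrightarrow> n \<in> S" and "\<And>n. n \<in> S \<Longrightarrow> f (Suc n) < f n"
  shows "strict_antimono_on S f"
proof -
  have "strict_mono_on S (\<lambda>n. - f n)"
    using assms by (intro strict_mono_on_SucI) auto
  then show ?thesis by (auto simp: monotone_on_def)
qed

text \<open>The growth factor ((n + 2) / (n + 1))^2 of the left side decreases in n, so b dominates
  it from n0 on once it does at n0. Later comparisons thus reduce to numerical checks at n0.\<close>

lemma quadratic_le_exponential:
  fixes b c :: real
  assumes "n0 \<le> n" "c \<ge> 0" "c * (real n0 + 1)\<^sup>2 \<le> b ^ n0"
    and "(real n0 + 2)\<^sup>2 \<le> b * (real n0 + 1)\<^sup>2" "b \<ge> 1"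
  shows "c * (real n + 1)\<^sup>2 \<le> b ^ n"
  using assms(1)
proof (induction n rule: dec_induct)
  case (step n)
  \<comment> \<open>This is (n + 2) / (n + 1) <= (n0 + 2) / (n0 + 1) with denominators
    cleared.\<close>
  have "(real n + 2) * (real n0 + 1) \<le> (real n0 + 2) * (real n + 1)"
    using step.hyps by (simp add: algebra_simps)
  then have "((real n + 2) * (real n0 + 1))\<^sup>2 \<le> ((real n0 + 2) * (real n + 1))\<^sup>2"
    by (intro power_mono) auto
  also have "\<dots> \<le> b * (real n0 + 1)\<^sup>2 * (real n + 1)\<^sup>2"
    using assms(4) by (simp add: power_mult_distrib mult_right_mono)
  finally have "(real n + 2)\<^sup>2 * (real n0 + 1)\<^sup>2 \<le> (b * (real n + 1)\<^sup>2) * (real n0 + 1)\<^sup>2"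
    by (simp add: power_mult_distrib mult_ac)
  then have "(real n + 2)\<^sup>2 \<le> b * (real n + 1)\<^sup>2"
    by (rule mult_right_le_imp_le) simp
  then have "c * (real (Suc n) + 1)\<^sup>2 \<le> b * (c * (real n + 1)\<^sup>2)"
    using mult_left_mono[OF _ assms(2)] by (fastforce simp: algebra_simps)
  also have "\<dots> \<le> b * b ^ n" using step.IH assms(5) by (intro mult_left_mono) auto
  finally show ?case by simp
qed (fact assms(3))

text \<open>The second derivative of ln x / x is (2 ln x - 3) / x^3, so for ln x >= 4 a margin of 1
  / x^3 is available; it will absorb the error terms of ln N_n.\<close>

lemma second_difference_ln_over_id:
  fixes x :: real
  assumes "x > 1" "ln x \<ge> 4"
  shows "2 * ln x / x + 1 / x ^ 3 \<le> ln (x + 1) / (x + 1) + ln (x - 1) / (x - 1)"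
proof -
  have x2: "x\<^sup>2 > 1" using assms(1) by (simp add: one_less_power)
  have "x > 2"
  proof (rule ccontr)
    assume "\<not> x > 2"
    then have "ln x \<le> 1" using ln_le_minus_one[of x] assms(1) by simp
    with assms(2) show False by simp
  qed
  then have x4: "x\<^sup>2 > 4" using power_strict_mono[of 2 x 2] by simp
  have p: "ln (x + 1) \<ge> ln x + 1 / (x + 1)"
  proof -
    \<comment> \<open>The inequality ln y <= y - 1 at y = x / (x + 1); the bound for ln (x - 1)
      takes y = x / (x - 1).\<close>
    have "ln (x / (x + 1)) \<le> x / (x + 1) - 1" using assms(1) by (intro ln_le_minus_one) auto
    also have "\<dots> = - 1 / (x + 1)" using assms(1) by (simp add: field_simps)
    finally show ?thesis using assms(1) by (simp add: ln_div)
  qed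
  have m: "ln (x - 1) \<ge> ln x - 1 / (x - 1)"
  proof -
    have "ln (x / (x - 1)) \<le> x / (x - 1) - 1" using assms(1) by (intro ln_le_minus_one) auto
    also have "\<dots> = 1 / (x - 1)" using assms(1) by (simp add: field_simps)
    finally show ?thesis using assms(1) by (simp add: ln_div)
  qed
  have "x\<^sup>2 * (4 * x\<^sup>2 - 8) - (x\<^sup>2 - 1)\<^sup>2 = x\<^sup>2 * (3 * x\<^sup>2 - 6) - 1"
    by (simp add: power2_eq_square algebra_simps)
  also have "\<dots> \<ge> 0" using mult_mono[of 1 "x\<^sup>2" 1 "3 * x\<^sup>2 - 6"] x4 by simp
  finally have "(x\<^sup>2 - 1)\<^sup>2 \<le> x\<^sup>2 * (4 * x\<^sup>2 - 8)" by simp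
  \<comment> \<open>The right side is what remains of the second difference after inserting
    \<open>p\<close> and \<open>m\<close> and replacing ln x by 4.\<close>
  then have "1 / x ^ 3 \<le> (4 * x\<^sup>2 - 8) / (x * (x\<^sup>2 - 1)\<^sup>2)"
    using assms(1) x2 by (simp add: divide_simps power2_eq_square power3_eq_cube mult_ac)
  also have "\<dots> = 4 * (2 / (x * (x\<^sup>2 - 1))) - 4 * x / (x\<^sup>2 - 1)\<^sup>2"
    using assms(1) x2 by (simp add: divide_simps) (simp add: power2_eq_square algebra_simps)
  also have "\<dots> \<le> ln x * (2 / (x * (x\<^sup>2 - 1))) - 4 * x / (x\<^sup>2 - 1)\<^sup>2"
    using assms x2 by (intro diff_right_mono mult_right_mono) auto
  also have "\<dots> = (ln x + 1 / (x + 1)) / (x + 1) + (ln x - 1 / (x - 1)) / (x - 1) - 2 * ln x / x"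
  proof -
    have eq: "x\<^sup>2 - 1 = (x + 1) * (x - 1)" by (simp add: power2_eq_square algebra_simps)
    have "x \<noteq> 0" "x + 1 \<noteq> 0" "x - 1 \<noteq> 0" using assms(1) by auto
    then show ?thesis
      unfolding eq by (simp add: divide_simps) (simp add: power2_eq_square algebra_simps)
  qed
  also have "\<dots> \<le> ln (x + 1) / (x + 1) + ln (x - 1) / (x - 1) - 2 * ln x / x"
    using p m assms(1) by (intro diff_right_mono add_mono divide_right_mono) auto
  finally show ?thesis by simp
qed

text \<open>The indices are 1 to 4, 19 to 23, and all divisors of the latter: with these, Gauss's
  formula can be solved for the counts that are needed exactly.\<close>

lemma divisor_lists:
  shows "filter (\<lambda>d. d dvd 1) [1..<1 + 1] = [1::nat]"
    and "filter (\<lambda>d. d dvd 2) [1..<2 + 1] = [1::nat, 2]"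
    and "filter (\<lambda>d. d dvd 3) [1..<3 + 1] = [1::nat, 3]"
    and "filter (\<lambda>d. d dvd 4) [1..<4 + 1] = [1::nat, 2, 4]"
    and "filter (\<lambda>d. d dvd 5) [1..<5 + 1] = [1::nat, 5]"
    and "filter (\<lambda>d. d dvd 7) [1..<7 + 1] = [1::nat, 7]"
    and "filter (\<lambda>d. d dvd 10) [1..<10 + 1] = [1::nat, 2, 5, 10]"
    and "filter (\<lambda>d. d dvd 11) [1..<11 + 1] = [1::nat, 11]"
    and "filter (\<lambda>d. d dvd 19) [1..<19 + 1] = [1::nat, 19]"
    and "filter (\<lambda>d. d dvd 20) [1..<20 + 1] = [1::nat, 2, 4, 5, 10, 20]"
    and "filter (\<lambda>d. d dvd 21) [1..<21 + 1] = [1::nat, 3, 7, 21]"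
    and "filter (\<lambda>d. d dvd 22) [1..<22 + 1] = [1::nat, 2, 11, 22]"
    and "filter (\<lambda>d. d dvd 23) [1..<23 + 1] = [1::nat, 23]"
  by code_simp+

text \<open>The estimates draw on polynomials only through Gauss's formula, so they are carried out
  for an abstract sequence.\<close>

locale gauss_sequence =
  fixes q :: nat and N :: "nat \<Rightarrow> nat"
  assumes q_ge_2: "q \<ge> 2"
    and gauss: "n > 0 \<Longrightarrow> (\<Sum>d | d dvd n. d * N d) = q ^ n"
begin

text \<open>The relative error e_n in n N_n = q^n caused by the proper divisors of n. The power of
  sqrt q expresses q^(n/2) for odd n as well.\<close>

definition err :: "nat \<Rightarrow> real" where
  "err n = real q / (real q - 1) / sqrt (real q) ^ n"

lemma err_pos: "err n > 0"
  using q_ge_2 by (simp add: err_def)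

lemma gauss_list:
  assumes "filter (\<lambda>d. d dvd n) [1..<n + 1] = ds" "n > 0"
  shows "(\<Sum>d\<leftarrow>ds. d * N d) = q ^ n"
proof -
  have "{d. d dvd n} = set ds"
    using assms(2) by (auto dest: dvd_imp_le intro: dvd_pos_nat simp flip: assms(1))
  moreover have "distinct ds" by (simp flip: assms(1))
  ultimately show ?thesis
    using gauss[OF assms(2)] by (simp add: sum.distinct_set_conv_list)
qed

section \<open>Two-sided bounds for n N_n\<close>

lemma mult_N_le: "n > 0 \<Longrightarrow> n * N n \<le> q ^ n"
  using member_le_sum[of n "{d. d dvd n}" "\<lambda>d. d * N d"] gauss[of n] by simp

text \<open>Every proper divisor d is at most n / 2 and contributes at most q^d, so the deficit from
  q^n is bounded by a geometric sum.\<close>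

lemma mult_N_ge:
  assumes "n > 0"
  shows "real n * real (N n) \<ge> real q ^ n * (1 - err n)"
proof -
  let ?s = "sqrt (real q)" and ?h = "n div 2"
  have "{d. d dvd n} \<subseteq> insert n {1..?h}"
  proof
    fix d assume "d \<in> {d. d dvd n}"
    then obtain k where k: "n = d * k" by (auto simp: dvd_def)
    with assms have "k > 0" "d > 0" by auto
    then show "d \<in> insert n {1..?h}"
      using k by (cases "k = 1") (auto simp: less_eq_div_iff_mult_less_eq)
  qed
  then have "q ^ n \<le> (\<Sum>d\<in>insert n {1..?h}. d * N d)"
    using assms unfolding gauss[OF assms, symmetric] by (intro sum_mono2) auto
  also have "\<dots> = n * N n + (\<Sum>d = 1..?h. d * N d)" using assms by simp
  also have "(\<Sum>d = 1..?h. d * N d) \<le> (\<Sum>d = 1..?h. q ^ d)"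
    using mult_N_le by (intro sum_mono) auto
  finally have "real (q ^ n) \<le> real (n * N n + (\<Sum>d = 1..?h. q ^ d))"
    by (simp only: of_nat_le_iff)
  then have *: "real q ^ n \<le> real n * real (N n) + (\<Sum>d = 1..?h. real q ^ d)"
    by (simp only: of_nat_add of_nat_mult of_nat_sum of_nat_power)
  \<comment> \<open>The geometric sum with its denominator q - 1 cleared.\<close>
  have "(\<Sum>d = 1..m. real q ^ d) * (real q - 1) = real q * real q ^ m - real q" for m
    by (induction m) (auto simp: algebra_simps)
  then have "(\<Sum>d = 1..?h. real q ^ d) \<le> real q / (real q - 1) * real q ^ ?h"
    using q_ge_2 by (simp add: pos_le_divide_eq)
  also have "real q ^ ?h = ?s ^ (2 * ?h)" by (simp add: power_mult)
  \<comment> \<open>Rounding in n div 2 is harmless: 2 * (n div 2) <= n and sqrt q >= 1.\<close>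
  also have "real q / (real q - 1) * \<dots> \<le> real q / (real q - 1) * ?s ^ n"
    using q_ge_2 by (intro mult_left_mono power_increasing) auto
  also have "real q / (real q - 1) * ?s ^ n = real q ^ n * err n"
  proof -
    have "real q ^ n = ?s ^ n * ?s ^ n" by (simp flip: power_mult_distrib)
    then show ?thesis using q_ge_2 by (simp add: err_def)
  qed
  finally show ?thesis using * q_ge_2 by (simp add: algebra_simps)
qed

lemma N_pos:
  assumes "n > 0" "err n < 1"
  shows "N n > 0"
proof -
  have "real q ^ n * (1 - err n) > 0" using assms q_ge_2 by simp
  with mult_N_ge[OF assms(1)] show ?thesis by (auto intro: Nat.gr0I)
qed

section \<open>Ratios of consecutive counts\<close>

lemma ratio_lessI:
  assumes "N n > 0" "N (n + 1) > 0" "N (n + 1) ^ 2 < N n * N (n + 2)"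
  shows "real (N (n + 1)) / real (N n) < real (N (Suc n + 1)) / real (N (Suc n))"
proof -
  have "real (N (n + 1) ^ 2) < real (N n * N (n + 2))" using assms(3) by (simp only: of_nat_less_iff)
  \<comment> \<open>Positivity rules out the default value 0 of division by zero before
    cross-multiplying.\<close>
  then show ?thesis using assms(1,2) by (simp add: divide_simps power2_eq_square mult_ac)
qed

text \<open>The second hypothesis is e_n + e_(n+2) <= 1 / (n+1)^2 with denominators cleared. Then (1
  - e_n) (1 - e_(n+2)) exceeds n (n+2) / (n+1)^2, so the lower bounds at n and n + 2 beat the upper
  bound at n + 1.\<close>

lemma N_ratio_less:
  assumes n: "n > 0"
    and le: "(real q + 1) * (real n + 1)\<^sup>2 \<le> (real q - 1) * sqrt (real q) ^ n"
  shows "real (N (n + 1)) / real (N n) < real (N (Suc n + 1)) / real (N (Suc n))"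
proof -
  let ?s = "sqrt (real q)" and ?Q = "real q ^ n * real q ^ (n + 2)"
  have "err (n + 2) = err n / real q" unfolding err_def power_add by simp
  also have "err n + \<dots> = (real q + 1) / (real q - 1) / ?s ^ n"
    using q_ge_2 by (simp add: err_def divide_simps)
  also have "\<dots> \<le> 1 / (real n + 1)\<^sup>2"
    using q_ge_2 le by (simp add: divide_simps mult_ac)
  finally have err: "err n + err (n + 2) \<le> 1 / (real n + 1)\<^sup>2" .
  also have "\<dots> < 1" using n by (simp add: one_less_power)
  finally have lt: "err n < 1" "err (n + 2) < 1" using err_pos[of n] err_pos[of "n + 2"] by auto
  moreover have "err (n + 1) \<le> err n"
    using q_ge_2 by (simp add: err_def divide_simps)
  ultimately have pos: "N n > 0" "N (n + 1) > 0" "N (n + 2) > 0" using n by (auto intro: N_pos)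
  have "(1 - 1 / (real n + 1)\<^sup>2) * (real n + 1)\<^sup>2 = (real n + 1)\<^sup>2 - 1"
    by (simp add: left_diff_distrib)
  also have "\<dots> = real n * (real n + 2)" by (simp add: power2_eq_square algebra_simps)
  finally have "real n * (real n + 2) * ?Q = ?Q * (1 - 1 / (real n + 1)\<^sup>2) * (real n + 1)\<^sup>2"
    by (simp only: mult_ac)
  also have "\<dots> \<le> ?Q * (1 - (err n + err (n + 2))) * (real n + 1)\<^sup>2"
    using err by (intro mult_right_mono mult_left_mono) auto
  \<comment> \<open>Strict because the product e_n e_(n+2) is positive.\<close>
  also have "\<dots> < ?Q * ((1 - err n) * (1 - err (n + 2))) * (real n + 1)\<^sup>2"
    using q_ge_2 err_pos[of n] err_pos[of "n + 2"]
    by (intro mult_strict_right_mono mult_strict_left_mono) (auto simp: algebra_simps)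
  also have "\<dots> = (real q ^ n * (1 - err n)) * (real q ^ (n + 2) * (1 - err (n + 2))) * (real n + 1)\<^sup>2"
    by (simp only: mult_ac)
  also have "\<dots> \<le> (real n * real (N n)) * (real (n + 2) * real (N (n + 2))) * (real n + 1)\<^sup>2"
    using n lt q_ge_2 by (intro mult_right_mono mult_mono mult_N_ge) auto
  finally have "real n * (real n + 2) * ?Q <
      real n * (real n + 2) * (real (N n) * real (N (n + 2)) * (real n + 1)\<^sup>2)"
    by (simp add: mult_ac add_ac)
  then have less: "?Q < real (N n) * real (N (n + 2)) * (real n + 1)\<^sup>2"
    using n by (simp add: mult_less_cancel_left)
  have "real ((n + 1) * N (n + 1)) \<le> real (q ^ (n + 1))"
    using mult_N_le[of "n + 1"] by (simp only: of_nat_le_iff)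
  then have "((real n + 1) * real (N (n + 1)))\<^sup>2 \<le> (real q ^ (n + 1))\<^sup>2"
    by (intro power_mono) (auto simp: algebra_simps)
  also have "\<dots> = ?Q" by (simp add: power2_eq_square)
  also note less
  finally have "(real (N (n + 1)))\<^sup>2 * (real n + 1)\<^sup>2 < real (N n) * real (N (n + 2)) * (real n + 1)\<^sup>2"
    by (simp add: power_mult_distrib mult_ac)
  then have "real (N (n + 1) ^ 2) < real (N n * N (n + 2))"
    by (simp add: mult_less_cancel_right)
  then show ?thesis using pos by (intro ratio_lessI) (auto simp only: of_nat_less_iff)
qed

section \<open>Logarithms and n-th roots\<close>

lemma err_le: "err n \<le> 2 / (7 / 5) ^ n"
proof -
  \<comment> \<open>Since 7/5 is a rational lower bound for sqrt 2, the estimate is uniform in q and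
    can be evaluated numerically.\<close>
  have "(7 / 5 :: real) \<le> sqrt (real q)"
    using q_ge_2 by (intro real_le_rsqrt) (simp add: power2_eq_square)
  then have "(7 / 5 :: real) ^ n \<le> sqrt (real q) ^ n" by (intro power_mono) auto
  moreover have "real q / (real q - 1) \<le> 2" using q_ge_2 by (simp add: divide_simps)
  ultimately show ?thesis
    unfolding err_def using q_ge_2 by (intro frac_le) auto
qed

lemma ln_N_le:
  assumes "n > 0" "N n > 0"
  shows "ln (N n) \<le> n * ln q - ln n"
proof -
  have "real (n * N n) \<le> real (q ^ n)" using mult_N_le[OF assms(1)] by (simp only: of_nat_le_iff)
  then have "ln (real n * real (N n)) \<le> ln (real q ^ n)"
    using assms q_ge_2 by (subst ln_le_cancel_iff) auto
  then show ?thesis using assms q_ge_2 by (simp add: ln_mult ln_realpow)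
qed

lemma ln_N_ge:
  assumes "n > 0" "err n \<le> 1 / 2"
  shows "ln (N n) \<ge> n * ln q - ln n - 2 * err n"
proof -
  have pos: "N n > 0" using assms N_pos by simp
  \<comment> \<open>For e = e_n > 0 this amounts to e <= 1/2, and -e - 2 e^2 is a lower bound for ln
    (1 - e) on that range.\<close>
  have "- 2 * err n \<le> - err n - 2 * (err n)\<^sup>2"
    using mult_right_mono[OF assms(2), of "err n"] err_pos[of n] by (simp add: power2_eq_square)
  also have "\<dots> \<le> ln (1 - err n)"
    using assms err_pos[of n] by (intro ln_one_minus_pos_lower_bound) auto
  finally have 1: "- 2 * err n \<le> ln (1 - err n)" .
  have "ln (real q ^ n * (1 - err n)) \<le> ln (real n * real (N n))"
    using assms q_ge_2 pos mult_N_ge by (subst ln_le_cancel_iff) auto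
  with 1 show ?thesis using assms pos q_ge_2 by (simp add: ln_mult ln_realpow)
qed

lemma root_N_eq:
  assumes "n > 0" "N n > 0"
  shows "root n (N n) = exp (ln (N n) / n)"
  using assms by (simp add: root_powr_inverse powr_def)

text \<open>On logarithms, after multiplying by n (n+1), it suffices that n (ln (n+1) + 2 e_(n+1)) <
  (n+1) ln n. Here n ln (n+1) <= n ln n + 1 and 2 n e_(n+1) <= 1, and 1 + 1 < 3 <= ln n.\<close>

lemma root_N_less:
  assumes "ln (real n) \<ge> 3" "n \<ge> 14"
  shows "root n (N n) < root (Suc n) (N (Suc n))"
proof -
  \<comment> \<open>The factor 8/25 is 4 / (25/2): since n + 1 >= 25/2, the quadratic dominates 4 (n
    + 1). At n = 14 it is 72 <= (7/5)^14.\<close>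
  have "8 / 25 * (real n + 1)\<^sup>2 \<le> (7 / 5) ^ n"
    by (rule quadratic_le_exponential[of 14])
      (use assms(2) in \<open>simp_all add: power2_eq_square power_divide\<close>)
  moreover have "4 * (real n + 1) \<le> 8 / 25 * (real n + 1)\<^sup>2"
    using assms(2) mult_right_mono[of "25 / 2" "real n + 1" "real n + 1"] by (simp add: power2_eq_square)
  ultimately have pow: "4 * (real n + 1) \<le> (7 / 5) ^ n" by linarith
  have e1: "real n * (2 * err (Suc n)) \<le> 1"
  proof -
    have "real n * (2 * err (Suc n)) \<le> real n * (2 * (2 / (7 / 5) ^ Suc n))"
      using err_le[of "Suc n"] by (intro mult_left_mono) auto
    also have "\<dots> = 20 / 7 * real n / (7 / 5) ^ n" by simp
    also have "\<dots> \<le> (4 * (real n + 1)) / (7 / 5) ^ n" by (intro divide_right_mono) auto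
    also have "\<dots> \<le> (7 / 5) ^ n / (7 / 5) ^ n" using pow by (intro divide_right_mono) auto
    also have "\<dots> = 1" by simp
    finally show ?thesis .
  qed
  have e: "err n \<le> 1 / 2" "err (Suc n) \<le> 1 / 2"
  proof -
    have "err n \<le> 2 / (7 / 5) ^ n" by (rule err_le)
    also have "\<dots> \<le> 2 / 4"
      using order_trans[OF _ pow, of 4] by (intro divide_left_mono) auto
    finally have "err n \<le> 2 / 4" .
    then show "err n \<le> 1 / 2" by simp
    have "14 * (2 * err (Suc n)) \<le> real n * (2 * err (Suc n))"
      using assms(2) err_pos[of "Suc n"] by (intro mult_right_mono) auto
    with e1 show "err (Suc n) \<le> 1 / 2" by simp
  qed
  have n: "n > 0" using assms(2) by simp
  have pos: "N n > 0" "N (Suc n) > 0" using N_pos e n by auto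
  have "ln (1 + 1 / real n) \<le> 1 / real n" by (rule ln_add_one_self_le_self) simp
  moreover have "1 + 1 / real n = real (Suc n) / real n" using n by (simp add: field_simps)
  ultimately have "ln (real (Suc n)) \<le> ln (real n) + 1 / real n"
    using n by (simp add: ln_div)
  then have "real n * ln (real (Suc n)) \<le> real n * ln (real n) + 1"
    using n mult_left_mono[of "ln (real (Suc n))" "ln (real n) + 1 / real n" "real n"]
    by (simp add: algebra_simps)
  with e1 assms(1) have main: "real n * (ln (real (Suc n)) + 2 * err (Suc n)) < real (Suc n) * ln (real n)"
    by (simp add: algebra_simps)
  have "real (Suc n) * ln (N n) \<le> real (Suc n) * (n * ln q - ln n)"
    using n pos by (intro mult_left_mono ln_N_le) auto
  also have "\<dots> < real n * (Suc n * ln q - ln (Suc n) - 2 * err (Suc n))"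
    using main by (simp add: algebra_simps)
  also have "\<dots> \<le> real n * ln (N (Suc n))"
    using e by (intro mult_left_mono ln_N_ge) auto
  finally have "ln (N n) / n < ln (N (Suc n)) / Suc n"
    using n by (simp add: divide_simps mult_ac)
  then show ?thesis using n pos by (simp add: root_N_eq del: of_nat_Suc)
qed

text \<open>Each ratio of roots is exp of a difference of F m = ln N_m / m, so F must be strictly
  concave at n + 1. Only the middle term needs a lower bound, and its doubled error 4 e_(n+1) /
  (n+1) stays below the margin 1 / (n+1)^3 of \<open>second_difference_ln_over_id\<close>.\<close>

lemma root_N_ratio_less:
  assumes "ln (real (Suc n)) \<ge> 4" "n \<ge> 30"
  shows "root (Suc (Suc n)) (N (Suc (Suc n))) / root (Suc n) (N (Suc n)) <
         root (Suc n) (N (Suc n)) / root n (N n)"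
proof -
  have e: "4 * err m < 1 / real m ^ 2" if "m \<ge> 30" for m
  proof -
    \<comment> \<open>The factor 8 is 4 times the 2 of \<open>err_le\<close>; the start is 8 * 31^2
      <= (7/5)^30.\<close>
    have "8 * (real m + 1)\<^sup>2 \<le> (7 / 5) ^ m"
      by (rule quadratic_le_exponential[of 30])
        (use that in \<open>simp_all add: power2_eq_square power_divide\<close>)
    moreover have "8 * real m ^ 2 < 8 * (real m + 1)\<^sup>2" by (simp add: power2_eq_square algebra_simps)
    ultimately have *: "8 * real m ^ 2 < (7 / 5) ^ m" by simp
    have "4 * err m \<le> 4 * (2 / (7 / 5) ^ m)" using err_le by (intro mult_left_mono) auto
    also have "\<dots> < 1 / real m ^ 2"
      using * that by (simp add: less_divide_eq divide_less_eq power_divide mult_ac)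
    finally show ?thesis .
  qed
  have e': "err m \<le> 1 / 2" if "m \<ge> 30" for m
  proof -
    have "1 / real m ^ 2 \<le> 1" using that by (simp add: divide_simps)
    with e[OF that] show ?thesis by simp
  qed
  define F where "F = (\<lambda>m. ln (real (N m)) / real m)"
  define x where "x = real (Suc n)"
  have x: "real (Suc (Suc n)) = x + 1" "real n = x - 1" "x > 1" using assms(2) by (auto simp: x_def)
  have pos: "N m > 0" if "m \<ge> 30" for m using N_pos[of m] e'[of m] that by simp
  have up: "F m \<le> ln q - ln m / m" if "m \<ge> 30" for m
    unfolding F_def using ln_N_le[of m] pos[of m] that by (simp add: field_simps)
  have "F (Suc n) \<ge> ln q - ln x / x - 2 * err (Suc n) / x"
    unfolding F_def using ln_N_ge[of "Suc n"] e'[of "Suc n"] assms(2)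
    using x(3) by (simp add: x_def[symmetric] divide_simps mult_ac del: of_nat_Suc)
  moreover have "4 * err (Suc n) / x < 1 / x ^ 3"
    using divide_strict_right_mono[OF e[of "Suc n", folded x_def], of x] assms(2) x(3)
    by (simp add: power2_eq_square power3_eq_cube)
  moreover have "F (Suc (Suc n)) \<le> ln q - ln (x + 1) / (x + 1)" "F n \<le> ln q - ln (x - 1) / (x - 1)"
    using up[of "Suc (Suc n)"] up[of n] assms(2) by (simp_all only: x)
  moreover have "2 * ln x / x + 1 / x ^ 3 \<le> ln (x + 1) / (x + 1) + ln (x - 1) / (x - 1)"
    using second_difference_ln_over_id x(3) assms(1) x_def by blast
  ultimately have "F (Suc (Suc n)) - F (Suc n) < F (Suc n) - F n" by simp
  moreover have "root m (N m) = exp (F m)" if "m \<ge> 30" for m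
    using root_N_eq[of m] pos[of m] that by (simp add: F_def)
  ultimately show ?thesis using assms(2) by (simp flip: exp_diff)
qed

section \<open>Starting indices for the ratios and exact small counts\<close>

lemma N_ratio_less_ge_9:
  assumes "q \<ge> 9" "n \<ge> 1"
  shows "real (N (n + 1)) / real (N n) < real (N (Suc n + 1)) / real (N (Suc n))"
proof (cases "n \<ge> 3")
  case True
  have "3 \<le> sqrt (real q)" using assms(1) by (intro real_le_rsqrt) simp
  \<comment> \<open>For q >= 9, (q + 1) / (q - 1) <= 5/4 and sqrt q >= 3; the start n = 3 works
    because 5/4 * 4^2 <= 3^3.\<close>
  have "(real q + 1) * (real n + 1)\<^sup>2 \<le> (real q - 1) * (5 / 4 * (real n + 1)\<^sup>2)"
    using mult_right_mono[of "real q + 1" "(real q - 1) * (5 / 4)" "(real n + 1)\<^sup>2"] assms(1)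
    by (simp add: mult_ac)
  also have "5 / 4 * (real n + 1)\<^sup>2 \<le> 3 ^ n"
    by (rule quadratic_le_exponential[OF True]) (simp_all add: power2_eq_square)
  also have "(3::real) ^ n \<le> sqrt (real q) ^ n" using \<open>3 \<le> sqrt (real q)\<close> by (intro power_mono) auto
  finally show ?thesis using N_ratio_less[of n] assms by simp
next
  case False
  have eqs: "N 1 = q" "N 1 + 2 * N 2 = q ^ 2" "N 1 + 3 * N 3 = q ^ 3" "N 1 + 2 * N 2 + 4 * N 4 = q ^ 4"
    using gauss_list[OF divisor_lists(1)] gauss_list[OF divisor_lists(2)] gauss_list[OF divisor_lists(3)] gauss_list[OF divisor_lists(4)]
    by (simp_all add: algebra_simps)
  define x where "x = real q"
  have x: "x \<ge> 9" using assms(1) by (simp add: x_def)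
  have N: "real (N 1) = x" "real (N 2) = (x ^ 2 - x) / 2" "real (N 3) = (x ^ 3 - x) / 3"
    "real (N 4) = (x ^ 4 - x ^ 2) / 4"
    using arg_cong[OF eqs(1), of real] arg_cong[OF eqs(2), of real] arg_cong[OF eqs(3), of real]
      arg_cong[OF eqs(4), of real] by (simp_all add: x_def)
  have "real (N 1) * real (N 3) - real (N 2) ^ 2 = x ^ 2 * (x - 1) * (x + 7) / 12"
    unfolding N by (simp add: field_simps eval_nat_numeral)
  moreover have "x ^ 2 * (x - 1) * (x + 7) / 12 > 0" using x by simp
  ultimately have "real (N 2 ^ 2) < real (N 1 * N 3)" by simp
  then have n1: "N 2 ^ 2 < N 1 * N 3" by (simp only: of_nat_less_iff)
  \<comment> \<open>The factor x - 8 is where q >= 9 enters: for x > 1 the difference is positive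
    exactly when x > 8.\<close>
  have "real (N 2) * real (N 4) - real (N 3) ^ 2 = x ^ 2 * (x - 1) ^ 2 * (x + 1) * (x - 8) / 72"
    unfolding N by (simp add: field_simps eval_nat_numeral)
  moreover have "x ^ 2 * (x - 1) ^ 2 * (x + 1) * (x - 8) / 72 > 0" using x by simp
  ultimately have "real (N 3 ^ 2) < real (N 2 * N 4)" by simp
  then have n2: "N 3 ^ 2 < N 2 * N 4" by (simp only: of_nat_less_iff)
  \<comment> \<open>The products on the right of \<open>n1\<close> and \<open>n2\<close> exceed
    squares, so none of their factors vanishes.\<close>
  have "N 1 > 0" "N 2 > 0" "N 3 > 0" using n1 n2 by (auto intro!: Nat.gr0I)
  moreover have "n = 1 \<or> n = 2" using False assms(2) by auto
  ultimately show ?thesis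
    using n1 n2 ratio_lessI[of 1] ratio_lessI[of 2] by (auto simp: numeral_eq_Suc)
qed

lemma N_ratio_less_ge_19:
  assumes "n \<ge> 19"
  shows "real (N (n + 1)) / real (N n) < real (N (Suc n + 1)) / real (N (Suc n))"
proof -
  consider "q \<ge> 3" | "q = 2" "n \<ge> 22" | "q = 2" "n \<in> {19, 20, 21}"
    using assms q_ge_2 by force
  then show ?thesis
  proof cases
    case 1
    \<comment> \<open>For q >= 3, (q + 1) / (q - 1) <= 2 and sqrt q >= 3/2, and 2 * 20^2 <=
      (3/2)^19.\<close>
    have "3 / 2 \<le> sqrt (real q)" using 1 by (intro real_le_rsqrt) (simp add: power2_eq_square)
    have "(real q + 1) * (real n + 1)\<^sup>2 \<le> (real q - 1) * (2 * (real n + 1)\<^sup>2)"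
      using mult_right_mono[of "real q + 1" "(real q - 1) * 2" "(real n + 1)\<^sup>2"] 1
      by (simp add: mult_ac)
    also have "2 * (real n + 1)\<^sup>2 \<le> (3 / 2) ^ n"
      by (rule quadratic_le_exponential[OF assms]) (simp_all add: power2_eq_square power_divide)
    also have "(3 / 2 :: real) ^ n \<le> sqrt (real q) ^ n"
      using \<open>3 / 2 \<le> sqrt (real q)\<close> by (intro power_mono) auto
    finally show ?thesis using N_ratio_less[of n] assms 1 by simp
  next
    case 2
    have "7 / 5 \<le> sqrt (real q)" using 2 by (intro real_le_rsqrt) (simp add: power2_eq_square)
    \<comment> \<open>For q = 2 the factor (q + 1) / (q - 1) is 3. At 22, 3 * 23^2 = 1587 is just
      below (7/5)^22; at 21 the comparison fails even with sqrt 2 in place of 7/5.\<close>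
    have "3 * (real n + 1)\<^sup>2 \<le> (7 / 5) ^ n"
      by (rule quadratic_le_exponential[OF 2(2)]) (simp_all add: power2_eq_square power_divide)
    also have "(7 / 5 :: real) ^ n \<le> sqrt (real q) ^ n"
      using \<open>7 / 5 \<le> sqrt (real q)\<close> by (intro power_mono) auto
    finally show ?thesis using N_ratio_less[of n] 2 by simp
  next
    case 3
    \<comment> \<open>Gauss's formula, solved upwards along divisibility, determines these values
      one after another.\<close>
    have N: "N 1 = 2" "N 2 = 1" "N 3 = 2" "N 4 = 3" "N 5 = 6" "N 7 = 18" "N 10 = 99" "N 11 = 186"
      "N 19 = 27594" "N 20 = 52377" "N 21 = 99858" "N 22 = 190557" "N 23 = 364722"
      using gauss_list[OF divisor_lists(1)] gauss_list[OF divisor_lists(2)] gauss_list[OF divisor_lists(3)] gauss_list[OF divisor_lists(4)] gauss_list[OF divisor_lists(5)] gauss_list[OF divisor_lists(6)] gauss_list[OF divisor_lists(7)] gauss_list[OF divisor_lists(8)] gauss_list[OF divisor_lists(9)] gauss_list[OF divisor_lists(10)]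
        gauss_list[OF divisor_lists(11)] gauss_list[OF divisor_lists(12)] gauss_list[OF divisor_lists(13)]
      by (simp_all add: 3(1))
    show ?thesis using 3(2) N by (auto simp: divide_simps)
  qed
qed

end

section \<open>The four claims for finite fields\<close>

theorem theorem1p1:
  fixes q :: nat
  assumes "primepow q"
    and "CARD('a :: finite_field) = q"
  shows "strict_mono_on {n. real n > exp (3 + 7 / (real q - 1)\<^sup>2)}
           (\<lambda>n. root n (real (num_monic_irreducible TYPE('a) n))) \<and>
         strict_antimono_on {n. real n \<ge> 5.835 * 10 ^ 14}
           (\<lambda>n. root (n + 1) (real (num_monic_irreducible TYPE('a) (n + 1)))
                / root n (real (num_monic_irreducible TYPE('a) n))) \<and>
         (q \<ge> 9 \<longrightarrow> strict_mono_on {1..}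
           (\<lambda>n. real (num_monic_irreducible TYPE('a) (n + 1))
                / real (num_monic_irreducible TYPE('a) n))) \<and>
         (q < 9 \<longrightarrow> strict_mono_on {19..}
           (\<lambda>n. real (num_monic_irreducible TYPE('a) (n + 1))
                / real (num_monic_irreducible TYPE('a) n)))"
proof -
  interpret gauss_sequence q "num_monic_irreducible TYPE('a)"
  proof
    show "q \<ge> 2" using primepow_gt_Suc_0[OF assms(1)] by simp
    show "(\<Sum>d | d dvd n. d * num_monic_irreducible TYPE('a) d) = q ^ n" if "n > 0" for n
      using sum_divisors_num_monic_irreducible[OF that, where 'a = 'a] assms(2) by simp
  qed
  show ?thesis
  proof (intro conjI impI)
    have exp3: "(14 :: real) \<le> exp 3"
    proof -
      \<comment> \<open>Splitting 3 into twelve quarters makes exp y >= 1 + y sharp enough: (5/4)^12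
        is about 14.55.\<close>
      have "(5 / 4 :: real) ^ 12 \<le> exp (1 / 4) ^ 12"
        using exp_ge_add_one_self[of "1 / 4 :: real"] by (intro power_mono) auto
      also have "\<dots> = exp 3" by (simp flip: exp_of_nat_mult)
      finally show ?thesis by (simp add: power_divide)
    qed
    show "strict_mono_on {n. real n > exp (3 + 7 / (real q - 1)\<^sup>2)}
           (\<lambda>n. root n (real (num_monic_irreducible TYPE('a) n)))"
    proof (rule strict_mono_on_SucI)
      fix n assume "n \<in> {n. real n > exp (3 + 7 / (real q - 1)\<^sup>2)}"
      \<comment> \<open>The exponent is at least 3, so n > exp 3 >= 14, which gives both hypotheses
        of \<open>root_N_less\<close>.\<close>
      moreover have "exp 3 \<le> exp (3 + 7 / (real q - 1)\<^sup>2)" by simp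
      ultimately have n: "real n > exp 3" using le_less_trans by blast
      with exp3 have "n \<ge> 14" by simp
      with n show "root n (real (num_monic_irreducible TYPE('a) n)) <
          root (Suc n) (real (num_monic_irreducible TYPE('a) (Suc n)))"
        by (intro root_N_less) (simp_all add: ln_ge_iff)
    qed (auto elim: less_le_trans)
    show "strict_antimono_on {n. real n \<ge> 5.835 * 10 ^ 14}
           (\<lambda>n. root (n + 1) (real (num_monic_irreducible TYPE('a) (n + 1)))
                / root n (real (num_monic_irreducible TYPE('a) n)))"
    proof (rule strict_antimono_on_SucI)
      fix n assume "n \<in> {n. real n \<ge> 5.835 * 10 ^ 14}"
      \<comment> \<open>Here 81 = 3^4 bounds exp 4, which yields ln (n + 1) >= 4 for
        \<open>root_N_ratio_less\<close>.\<close>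
      then have n: "real n \<ge> 81" by simp
      have "exp (4 :: real) = exp 1 ^ 4" by (simp flip: exp_of_nat_mult)
      also have "\<dots> \<le> 3 ^ 4" using exp_le by (intro power_mono) auto
      finally have "exp 4 \<le> real (Suc n)" using n by simp
      then have "ln (real (Suc n)) \<ge> 4" by (subst ln_ge_iff) auto
      with n show "root (Suc n + 1) (real (num_monic_irreducible TYPE('a) (Suc n + 1)))
            / root (Suc n) (real (num_monic_irreducible TYPE('a) (Suc n)))
          < root (n + 1) (real (num_monic_irreducible TYPE('a) (n + 1)))
            / root n (real (num_monic_irreducible TYPE('a) n))"
        using root_N_ratio_less[of n] by simp
    qed auto
    show "strict_mono_on {1..} (\<lambda>n. real (num_monic_irreducible TYPE('a) (n + 1))
            / real (num_monic_irreducible TYPE('a) n))" if "q \<ge> 9"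
      using N_ratio_less_ge_9[OF that] by (intro strict_mono_on_SucI) auto
    show "strict_mono_on {19..} (\<lambda>n. real (num_monic_irreducible TYPE('a) (n + 1))
            / real (num_monic_irreducible TYPE('a) n))" if "q < 9"
      using N_ratio_less_ge_19 by (intro strict_mono_on_SucI) auto
  qed
qed

end
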